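(* Let $k\ge 0$ be an integer and let $\{p_n\}_{n=0}^k$ be a finite orthonormal polynomial sequence in $V(\mathcal{I},w)$, of Type A or of Type B. Define functions $\beta_n^k(x)$, $x\in\mathcal{I}$, $n=0,\dots,k$, by (i) $$\beta_n^k(x)=\sum_{j=n}^k a_n^j\, p_j(x)$$ if $\{p_n\}_{n=0}^k$ is of Type A, with $p_n(x)=\sum_{i=0}^n a_i^n x^i$; or (ii) $$\beta_n^k(x)=\sum_{i=0}^{\lfloor (k-n)/2\rfloor} a_i^{2i+n}\, p_{2i+n}(x)$$ if $\{p_n\}_{n=0}^k$ is of Type B, with $p_n(x)=\sum_{i=0}^{\lfloor n/2\rfloor} a_i^n x^{n-2i}$. Then the orthogonal projector $\hat{P}_{V_k}:V(\mathcal{I},w)\to V_k$ can be represented as $$\hat{P}_{V_k}=\sum_{i=0}^k x^i\,\langle\,\cdot\,,\beta_i^k\rangle,$$ i.e. $\hat{P}_{V_k}f=\sum_{i=0}^k \langle f,\beta_i^k\rangle\, x^i$ for every $f\in V(\mathcal{I},w)$.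
   Context: $\mathcal{I}\subseteq\mathbb{R}$ is an interval and $w$ is a weight function with $w(x)\ge 0$ for all $x\in\mathcal{I}$. $V=V(\mathcal{I},w)$ denotes a finite-dimensional inner product space of real functions on $\mathcal{I}$ with inner product $\langle f,g\rangle=\int_{\mathcal{I}} f(x)g(x)w(x)\,dx$, and $V_k=\mathrm{Span}(\{x^0,x,\dots,x^k\})\subseteq V(\mathcal{I},w)$ is the subspace spanned by the monomials on $\mathcal{I}$ ($x^0=1$). Superscripts on coefficients $a_i^n$ and on $\beta_n^k$ are labels, not powers; superscripts on the variable $x$ are powers. A Type A orthonormal polynomial sequence is a sequence of functions $p_n(x)=\sum_{i=0}^n a_i^n x^i$ with real coefficients and $a_n^n\neq 0$, such that $\langle p_n,p_m\rangle=\delta_{n,m}$. A Type B orthonormal polynomial sequence is a sequence of functions $p_n(x)=\sum_{i=0}^{\lfloor n/2\rfloor} a_i^n x^{n-2i}$ with real coefficients and $a_0^n\neq 0$, such that $\langle p_n,p_m\rangle=\delta_{n,m}$. Here $\lfloor\cdot\rfloor$ is the integer part and $\delta_{n,m}$ is the Kronecker delta. The orthogonal projector $\hat{P}_{V_k}:V\to V_k$ is the idempotent linear map with $\hat{P}_{V_k}f_k=f_k$ for all $f_k\in V_k$ and $\hat{P}_{V_k}g=0$ for all $g\in V_k^\perp=\{g\in V:\langle g,f_k\rangle=0\ \forall f_k\in V_k\}$, where $V=V_k\oplus V_k^\perp$. *)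

theory Defs
  imports "HOL-Analysis.Analysis" "HOL-Library.Function_Algebras"
begin

text \<open>
  A real function on an interval \<open>I\<close> is represented by its extension by zero to the whole
  real line, so that functions on \<open>I\<close> are equal iff their representatives are.  These
  representatives form a subspace of the real vector space of all functions with the pointwise
  operations: addition comes from \<^theory>\<open>HOL-Library.Function_Algebras\<close>, and scaling
  is the following.
\<close>

definition fscale :: "real \<Rightarrow> (real \<Rightarrow> real) \<Rightarrow> real \<Rightarrow> real" where
  "fscale c f = (\<lambda>x. c * f x)"

interpretation fun_vs: vector_space fscale
  by unfold_locales (auto simp: fscale_def fun_eq_iff algebra_simps)

definition functions_on :: "real set \<Rightarrow> (real \<Rightarrow> real) set" where
  "functions_on I = {f. \<forall>x. x \<notin> I \<longrightarrow> f x = 0}"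

definition wip :: "real set \<Rightarrow> (real \<Rightarrow> real) \<Rightarrow> (real \<Rightarrow> real) \<Rightarrow> (real \<Rightarrow> real) \<Rightarrow> real" where
  "wip I w f g = (LINT x:I|lebesgue. f x * g x * w x)"

text \<open>
  Symmetry, bilinearity and nonnegativity of the weighted inner product follow from integrability
  and \<open>w \<ge> 0\<close>; definiteness is genuinely an assumption, because elements of \<open>V\<close> are
  functions rather than classes of functions modulo null sets.
\<close>

locale weighted_function_space =
  fixes I :: "real set" and w :: "real \<Rightarrow> real" and V :: "(real \<Rightarrow> real) set"
  assumes interval: "is_interval I"
    and weight_nonneg: "\<And>x. x \<in> I \<Longrightarrow> 0 \<le> w x"
    and on_interval: "V \<subseteq> functions_on I"
    and subspace: "fun_vs.subspace V"
    and finite_dimensional: "\<exists>B. finite B \<and> fun_vs.span B = V"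
    and integrable: "\<And>f g. f \<in> V \<Longrightarrow> g \<in> V \<Longrightarrow> set_integrable lebesgue I (\<lambda>x. f x * g x * w x)"
    and definite: "\<And>f. f \<in> V \<Longrightarrow> wip I w f f = 0 \<Longrightarrow> f = 0"

definition monomial_on :: "real set \<Rightarrow> nat \<Rightarrow> real \<Rightarrow> real" where
  "monomial_on I i = (\<lambda>x. if x \<in> I then x ^ i else 0)"

definition poly_space :: "real set \<Rightarrow> nat \<Rightarrow> (real \<Rightarrow> real) set" where
  "poly_space I k = fun_vs.span (monomial_on I ` {..k})"

text \<open>In both types below, \<open>a n i\<close> is the coefficient written \<open>a\<^sub>i\<^sup>n\<close>.\<close>

definition orthonormal_upto ::
  "real set \<Rightarrow> (real \<Rightarrow> real) \<Rightarrow> (real \<Rightarrow> real) set \<Rightarrow> nat \<Rightarrow> (nat \<Rightarrow> real \<Rightarrow> real) \<Rightarrow> bool" where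
  "orthonormal_upto I w V k p \<longleftrightarrow>
     (\<forall>n\<le>k. p n \<in> V) \<and>
     (\<forall>n\<le>k. \<forall>m\<le>k. wip I w (p n) (p m) = (if n = m then 1 else 0))"

definition type_A ::
  "real set \<Rightarrow> (real \<Rightarrow> real) \<Rightarrow> (real \<Rightarrow> real) set \<Rightarrow> nat \<Rightarrow>
   (nat \<Rightarrow> nat \<Rightarrow> real) \<Rightarrow> (nat \<Rightarrow> real \<Rightarrow> real) \<Rightarrow> bool" where
  "type_A I w V k a p \<longleftrightarrow>
     orthonormal_upto I w V k p \<and>
     (\<forall>n\<le>k. a n n \<noteq> 0 \<and> (\<forall>x\<in>I. p n x = (\<Sum>i=0..n. a n i * x ^ i)))"

definition type_B ::
  "real set \<Rightarrow> (real \<Rightarrow> real) \<Rightarrow> (real \<Rightarrow> real) set \<Rightarrow> nat \<Rightarrow>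
   (nat \<Rightarrow> nat \<Rightarrow> real) \<Rightarrow> (nat \<Rightarrow> real \<Rightarrow> real) \<Rightarrow> bool" where
  "type_B I w V k a p \<longleftrightarrow>
     orthonormal_upto I w V k p \<and>
     (\<forall>n\<le>k. a n 0 \<noteq> 0 \<and> (\<forall>x\<in>I. p n x = (\<Sum>i=0..n div 2. a n i * x ^ (n - 2 * i))))"

definition beta_A :: "nat \<Rightarrow> (nat \<Rightarrow> nat \<Rightarrow> real) \<Rightarrow> (nat \<Rightarrow> real \<Rightarrow> real) \<Rightarrow> nat \<Rightarrow> real \<Rightarrow> real" where
  "beta_A k a p n = (\<lambda>x. \<Sum>j=n..k. a j n * p j x)"

definition beta_B :: "nat \<Rightarrow> (nat \<Rightarrow> nat \<Rightarrow> real) \<Rightarrow> (nat \<Rightarrow> real \<Rightarrow> real) \<Rightarrow> nat \<Rightarrow> real \<Rightarrow> real" where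
  "beta_B k a p n = (\<lambda>x. \<Sum>i=0..(k - n) div 2. a (2 * i + n) i * p (2 * i + n) x)"

definition orth_compl ::
  "real set \<Rightarrow> (real \<Rightarrow> real) \<Rightarrow> (real \<Rightarrow> real) set \<Rightarrow> (real \<Rightarrow> real) set \<Rightarrow> (real \<Rightarrow> real) set" where
  "orth_compl I w V U = {g \<in> V. \<forall>u\<in>U. wip I w g u = 0}"

definition is_orth_projector ::
  "real set \<Rightarrow> (real \<Rightarrow> real) \<Rightarrow> (real \<Rightarrow> real) set \<Rightarrow> (real \<Rightarrow> real) set \<Rightarrow>
   ((real \<Rightarrow> real) \<Rightarrow> real \<Rightarrow> real) \<Rightarrow> bool" where
  "is_orth_projector I w V U P \<longleftrightarrow>
     (\<forall>f\<in>V. P f \<in> U) \<and>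
     (\<forall>f\<in>V. \<forall>g\<in>V. P (f + g) = P f + P g) \<and>
     (\<forall>c. \<forall>f\<in>V. P (fscale c f) = fscale c (P f)) \<and>
     (\<forall>f\<in>V. P (P f) = P f) \<and>
     (\<forall>u\<in>U. P u = u) \<and>
     (\<forall>g\<in>orth_compl I w V U. P g = 0)"

text \<open>
  The conditions above only constrain \<open>P\<close> on \<open>V\<close>; requiring \<open>P\<close> to be
  extensional pins down its irrelevant values elsewhere, so that the description has a unique
  solution whenever \<open>U\<close> is a subspace of a finite-dimensional inner product space \<open>V\<close>.
\<close>

definition orth_projector ::
  "real set \<Rightarrow> (real \<Rightarrow> real) \<Rightarrow> (real \<Rightarrow> real) set \<Rightarrow> (real \<Rightarrow> real) set \<Rightarrow>
   (real \<Rightarrow> real) \<Rightarrow> real \<Rightarrow> real" where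
  "orth_projector I w V U = (THE P. P \<in> extensional V \<and> is_orth_projector I w V U P)"

end

theory Submission
  imports Defs
begin

text \<open>
  An orthonormal basis \<open>p\<^sub>0, \<dots>, p\<^sub>k\<close> of a subspace \<open>U\<close> gives the projector onto
  \<open>U\<close> as the Fourier sum \<open>f \<mapsto> \<Sum>n. \<langle>f, p\<^sub>n\<rangle> p\<^sub>n\<close> (\<open>orth_projector_orthonormal\<close>).  For polynomials of
  Type A the matrix of coefficients \<open>a\<^sub>i\<^sup>n\<close> is lower triangular with nonzero diagonal, hence
  invertible, so the \<open>p\<^sub>n\<close> span the same space as the monomials
  (\<open>span_triangular_eq\<close>).  Expanding the outer factor \<open>p\<^sub>n\<close> of the Fourier sum in monomials and
  collecting the coefficient of \<open>x\<^sup>i\<close> gives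
  \<open>\<Sum>n\<ge>i. \<langle>f, p\<^sub>n\<rangle> a\<^sub>i\<^sup>n = \<langle>f, \<beta>\<^sub>i\<rangle>\<close>: the functions \<open>\<beta>\<^sub>i\<close> are simply what the bilinearity of
  the inner product produces when the order of summation is exchanged.

  Type B is Type A with the coefficients of the wrong parity equal to zero, labelled by half the
  distance from the leading term.  After relabelling, the two definitions of \<open>\<beta>\<close> agree.
\<close>

section \<open>The weighted inner product\<close>

lemma sum_fscale_apply: "(\<Sum>i\<in>A. fscale (c i) (f i)) x = (\<Sum>i\<in>A. c i * f i x)"
  by (induction A rule: infinite_finite_induct) (auto simp: fscale_def)

lemma wip_commute: "wip I w f g = wip I w g f"
  by (simp add: wip_def mult.commute)

lemma wip_scale_left: "wip I w (fscale c f) g = c * wip I w f g"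
  by (simp add: wip_def fscale_def mult.assoc)

lemma wip_scale_right: "wip I w f (fscale c g) = c * wip I w f g"
  by (metis wip_commute wip_scale_left)

lemma wip_zero_right: "wip I w f 0 = 0"
  by (simp add: wip_def set_lebesgue_integral_def)

context weighted_function_space
begin

lemma wip_add_left:
  assumes "f \<in> V" "g \<in> V" "h \<in> V"
  shows "wip I w (f + g) h = wip I w f h + wip I w g h"
  using set_integral_add(2)[OF integrable[OF assms(1,3)] integrable[OF assms(2,3)]]
  by (simp add: wip_def distrib_right)

lemma wip_add_right:
  assumes "f \<in> V" "g \<in> V" "h \<in> V"
  shows "wip I w f (g + h) = wip I w f g + wip I w f h"
  using wip_add_left[OF assms(2,3,1)] by (simp add: wip_commute)

lemma wip_sum_right:
  assumes "f \<in> V" "\<And>i. i \<in> A \<Longrightarrow> g i \<in> V"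
  shows "wip I w f (\<Sum>i\<in>A. fscale (c i) (g i)) = (\<Sum>i\<in>A. c i * wip I w f (g i))"
  using assms(2)
proof (induction A rule: infinite_finite_induct)
  case (insert i A)
  have "(\<Sum>i\<in>A. fscale (c i) (g i)) \<in> V" "fscale (c i) (g i) \<in> V"
    using insert.prems by (auto intro!: fun_vs.subspace_sum fun_vs.subspace_scale subspace)
  then have "wip I w f (fscale (c i) (g i) + (\<Sum>i\<in>A. fscale (c i) (g i)))
      = c i * wip I w f (g i) + wip I w f (\<Sum>i\<in>A. fscale (c i) (g i))"
    using assms(1) by (simp only: wip_add_right wip_scale_right)
  moreover have "wip I w f (\<Sum>i\<in>A. fscale (c i) (g i)) = (\<Sum>i\<in>A. c i * wip I w f (g i))"
    using insert.prems by (intro insert.IH) auto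
  ultimately show ?case
    by (simp only: sum.insert[OF insert.hyps])
qed (simp_all add: wip_zero_right)

section \<open>The projector as a Fourier sum\<close>

text \<open>
  The decomposition hypothesis says \<open>V = U + U\<^sup>\<bottom>\<close>.  A projector is prescribed on each summand and
  additive, so it is determined on all of \<open>V\<close>; this uniqueness is what gives the definite
  description in \<^const>\<open>orth_projector\<close> a value.
\<close>

lemma orth_projector_eqI:
  assumes P: "is_orth_projector I w V U P"
    and decomp: "\<And>f. f \<in> V \<Longrightarrow> f - P f \<in> orth_compl I w V U"
    and "U \<subseteq> V" "f \<in> V"
  shows "orth_projector I w V U f = P f"
proof -
  have PU: "P f \<in> U" and PV: "P f \<in> V" if "f \<in> V" for f
    using P that assms(3) by (auto simp: is_orth_projector_def)
  have "orth_projector I w V U = restrict P V"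
    unfolding orth_projector_def
  proof (rule the_equality)
    have "f + g \<in> V" "fscale c f \<in> V" if "f \<in> V" "g \<in> V" for f g c
      using that subspace by (auto intro: fun_vs.subspace_add fun_vs.subspace_scale)
    then show "restrict P V \<in> extensional V \<and> is_orth_projector I w V U (restrict P V)"
      using P PV assms(3) by (auto simp: is_orth_projector_def orth_compl_def)
  next
    fix Q assume Q: "Q \<in> extensional V \<and> is_orth_projector I w V U Q"
    have "Q f = P f" if f: "f \<in> V" for f
    proof -
      have "Q f = Q (P f + (f - P f))" by simp
      also have "\<dots> = Q (P f) + Q (f - P f)"
        using Q PV[OF f] decomp[OF f] unfolding is_orth_projector_def orth_compl_def by blast
      also have "Q (P f) = P f" using Q PU[OF f] unfolding is_orth_projector_def by blast
      also have "Q (f - P f) = 0" using Q decomp[OF f] unfolding is_orth_projector_def by blast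
      finally show ?thesis by simp
    qed
    then show "Q = restrict P V" using Q by (auto simp: extensional_def restrict_def)
  qed
  then show ?thesis using assms(4) by simp
qed

text \<open>
  Write \<open>P\<close> for the Fourier sum.  The vectors fixed by \<open>P\<close>, and for each \<open>f\<close> the vectors orthogonal
  to \<open>f - P f\<close>, form subspaces.  By orthonormality these contain every \<open>p\<^sub>n\<close>, hence the whole span.
\<close>

lemma orth_projector_orthonormal:
  assumes orth: "orthonormal_upto I w V k p" and f: "f \<in> V"
  shows "orth_projector I w V (fun_vs.span (p ` {..k})) f
    = (\<Sum>n=0..k. fscale (wip I w f (p n)) (p n))"
proof -
  let ?U = "fun_vs.span (p ` {..k})"
  define P where "P f = (\<Sum>n=0..k. fscale (wip I w f (p n)) (p n))" for f
  have pV: "p n \<in> V" if "n \<le> k" for n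
    using orth that by (simp add: orthonormal_upto_def)
  have pp: "wip I w (p n) (p m) = (if n = m then 1 else 0)" if "n \<le> k" "m \<le> k" for n m
    using orth that by (simp add: orthonormal_upto_def)
  have UV: "?U \<subseteq> V" using pV subspace by (intro fun_vs.span_minimal) auto
  have PU: "P f \<in> ?U" for f
    unfolding P_def by (intro fun_vs.span_sum fun_vs.span_scale fun_vs.span_base) auto
  have PV: "P f \<in> V" for f using PU UV by blast
  have P_add: "P (f + g) = P f + P g" if "f \<in> V" "g \<in> V" for f g
    using that pV by (simp add: P_def wip_add_left fun_vs.scale_left_distrib sum.distrib)
  have P_scale: "P (fscale c f) = fscale c (P f)" for c f
    by (simp add: P_def wip_scale_left fun_vs.scale_sum_right)
  have P_p: "P (p m) = p m" if "m \<le> k" for m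
  proof -
    have "P (p m) = (\<Sum>n=0..k. if m = n then p n else 0)"
      unfolding P_def using that by (intro sum.cong) (auto simp: pp)
    then show ?thesis using that by (simp add: sum.delta')
  qed
  have P_id: "P u = u" if "u \<in> ?U" for u
  proof -
    have "fun_vs.subspace {u \<in> V. P u = u}"
      using subspace P_add P_scale P_scale[of 0 0]
      by (auto simp: fun_vs.subspace_def)
    then have "?U \<subseteq> {u \<in> V. P u = u}"
      using pV P_p by (intro fun_vs.span_minimal) auto
    then show ?thesis using that by blast
  qed
  have decomp: "f - P f \<in> orth_compl I w V ?U" if f: "f \<in> V" for f
  proof -
    have rV: "f - P f \<in> V" using subspace f PV by (intro fun_vs.subspace_diff)
    have "wip I w (f - P f) (p m) = 0" if m: "m \<le> k" for m
    proof -
      have "wip I w (P f) (p m) = wip I w (p m) (P f)" by (rule wip_commute)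
      also have "\<dots> = (\<Sum>n=0..k. wip I w f (p n) * wip I w (p m) (p n))"
        unfolding P_def using pV m by (intro wip_sum_right) auto
      also have "\<dots> = (\<Sum>n=0..k. if m = n then wip I w f (p n) else 0)"
        using m by (intro sum.cong) (auto simp: pp)
      also have "\<dots> = wip I w f (p m)" using m by (simp add: sum.delta')
      finally show ?thesis
        using wip_add_left[OF rV PV pV[OF m], of f] by simp
    qed
    moreover have "fun_vs.subspace {u \<in> V. wip I w (f - P f) u = 0}"
      using subspace rV
      by (auto simp: fun_vs.subspace_def wip_zero_right wip_add_right wip_scale_right)
    ultimately have "?U \<subseteq> {u \<in> V. wip I w (f - P f) u = 0}"
      using pV by (intro fun_vs.span_minimal) auto
    then show ?thesis using rV by (auto simp: orth_compl_def)
  qed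
  have "P g = 0" if "g \<in> orth_compl I w V ?U" for g
  proof -
    have "wip I w g (p n) = 0" if "n \<le> k" for n
      using \<open>g \<in> _\<close> that fun_vs.span_base[of "p n" "p ` {..k}"] by (auto simp: orth_compl_def)
    then show ?thesis by (simp add: P_def)
  qed
  then have "is_orth_projector I w V ?U P"
    unfolding is_orth_projector_def using PU P_add P_scale P_id by blast
  then have "orth_projector I w V ?U f = P f"
    using decomp UV f by (rule orth_projector_eqI)
  then show ?thesis by (simp add: P_def)
qed

end

section \<open>Triangular expansions\<close>

text \<open>
  Forward substitution: the \<open>n\<close>-th equation expresses \<open>m n\<close> through \<open>p n\<close> and the \<open>m i\<close> with
  \<open>i < n\<close>, because the diagonal coefficient can be divided out.
\<close>

lemma span_triangular_eq:
  fixes k :: nat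
  assumes p: "\<And>n. n \<le> k \<Longrightarrow> p n = (\<Sum>i=0..n. fscale (a n i) (m i))"
    and diag: "\<And>n. n \<le> k \<Longrightarrow> a n n \<noteq> 0"
  shows "fun_vs.span (p ` {..k}) = fun_vs.span (m ` {..k})"
proof
  have "p n \<in> fun_vs.span (m ` {..k})" if "n \<le> k" for n
    unfolding p[OF that] using that
    by (intro fun_vs.span_sum fun_vs.span_scale fun_vs.span_base imageI) auto
  then show "fun_vs.span (p ` {..k}) \<subseteq> fun_vs.span (m ` {..k})"
    by (intro fun_vs.span_minimal) auto
  have "m n \<in> fun_vs.span (p ` {..k})" if "n \<le> k" for n
    using that
  proof (induction n rule: less_induct)
    case (less n)
    have "{0..n} = insert n {..<n}" by auto
    then have "p n = fscale (a n n) (m n) + (\<Sum>i<n. fscale (a n i) (m i))"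
      using p[OF less.prems] by simp
    then have "fscale (a n n) (m n) = p n - (\<Sum>i<n. fscale (a n i) (m i))"
      by simp
    also have "\<dots> \<in> fun_vs.span (p ` {..k})"
      using less
      by (intro fun_vs.span_diff fun_vs.span_sum fun_vs.span_scale) (auto intro: fun_vs.span_base)
    finally have "fscale (1 / a n n) (fscale (a n n) (m n)) \<in> fun_vs.span (p ` {..k})"
      by (rule fun_vs.span_scale)
    then show ?case using diag[OF less.prems] by simp
  qed
  then show "fun_vs.span (m ` {..k}) \<subseteq> fun_vs.span (p ` {..k})"
    by (intro fun_vs.span_minimal) auto
qed

lemma (in weighted_function_space) orth_projector_type_A:
  assumes A: "type_A I w V k a p" and f: "f \<in> V"
  shows "orth_projector I w V (poly_space I k) f
    = (\<Sum>i=0..k. fscale (wip I w f (beta_A k a p i)) (monomial_on I i))"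
proof -
  let ?m = "monomial_on I"
  have orth: "orthonormal_upto I w V k p" using A by (simp add: type_A_def)
  have pV: "p n \<in> V" if "n \<le> k" for n
    using orth that by (simp add: orthonormal_upto_def)
  have p: "p n = (\<Sum>i=0..n. fscale (a n i) (?m i))" if "n \<le> k" for n
  proof
    fix x
    show "p n x = (\<Sum>i=0..n. fscale (a n i) (?m i)) x"
      using A pV[OF that] on_interval that
      by (cases "x \<in> I") (auto simp: type_A_def sum_fscale_apply monomial_on_def functions_on_def)
  qed
  have span: "fun_vs.span (p ` {..k}) = poly_space I k"
    unfolding poly_space_def using p A
    by (intro span_triangular_eq) (auto simp: type_A_def)
  have beta: "wip I w f (beta_A k a p i) = (\<Sum>n=i..k. wip I w f (p n) * a n i)" for i
  proof -
    have "beta_A k a p i = (\<Sum>n=i..k. fscale (a n i) (p n))"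
      by (auto simp: beta_A_def sum_fscale_apply)
    then have "wip I w f (beta_A k a p i) = wip I w f (\<Sum>n=i..k. fscale (a n i) (p n))"
      by (rule arg_cong)
    also have "\<dots> = (\<Sum>n=i..k. a n i * wip I w f (p n))"
      using f pV by (intro wip_sum_right) auto
    finally show ?thesis by (simp add: mult.commute)
  qed
  have "orth_projector I w V (poly_space I k) f = (\<Sum>n=0..k. fscale (wip I w f (p n)) (p n))"
    using orth_projector_orthonormal[OF orth f] by (simp add: span)
  \<comment> \<open>The filtered index sets put the triangular sum into the form required for the exchange.\<close>
  also have "\<dots> = (\<Sum>n=0..k. \<Sum>i | i \<in> {0..k} \<and> i \<le> n. fscale (wip I w f (p n) * a n i) (?m i))"
  proof (rule sum.cong)
    fix n assume "n \<in> {0..k}"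
    then have "n \<le> k" "{i. i \<in> {0..k} \<and> i \<le> n} = {0..n}" by auto
    then show "fscale (wip I w f (p n)) (p n)
        = (\<Sum>i | i \<in> {0..k} \<and> i \<le> n. fscale (wip I w f (p n) * a n i) (?m i))"
      using p[OF \<open>n \<le> k\<close>] by (metis (no_types, lifting) fun_vs.scale_scale fun_vs.scale_sum_right sum.cong)
  qed simp
  also have "\<dots> = (\<Sum>i=0..k. \<Sum>n | n \<in> {0..k} \<and> i \<le> n. fscale (wip I w f (p n) * a n i) (?m i))"
    by (rule sum.swap_restrict) auto
  also have "\<dots> = (\<Sum>i=0..k. \<Sum>n=i..k. fscale (wip I w f (p n) * a n i) (?m i))"
    by (intro sum.cong) auto
  also have "\<dots> = (\<Sum>i=0..k. fscale (wip I w f (beta_A k a p i)) (?m i))"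
    by (simp add: beta fun_vs.scale_sum_left)
  finally show ?thesis .
qed

section \<open>Type B as a special case of Type A\<close>

text \<open>The coefficient of \<open>x\<^sup>i\<close> in \<open>\<Sum>j. a\<^sub>j\<^sup>n x\<^sup>n\<^sup>-\<^sup>2\<^sup>j\<close>, for \<open>i \<le> n\<close>.\<close>

definition parity_coeff :: "(nat \<Rightarrow> nat \<Rightarrow> real) \<Rightarrow> nat \<Rightarrow> nat \<Rightarrow> real" where
  "parity_coeff a n i = (if even (n - i) then a n ((n - i) div 2) else 0)"

lemma type_A_parity_coeff:
  assumes "type_B I w V k a p"
  shows "type_A I w V k (parity_coeff a) p"
proof -
  have "(\<Sum>i=0..n div 2. a n i * x ^ (n - 2 * i)) = (\<Sum>i=0..n. parity_coeff a n i * x ^ i)" for n x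
  proof -
    have "(\<Sum>i=0..n div 2. a n i * x ^ (n - 2 * i))
        = (\<Sum>i | i \<le> n \<and> even (n - i). parity_coeff a n i * x ^ i)"
      by (rule sum.reindex_bij_witness[of _ "\<lambda>i. (n - i) div 2" "\<lambda>i. n - 2 * i"])
        (auto simp: parity_coeff_def)
    also have "\<dots> = (\<Sum>i=0..n. parity_coeff a n i * x ^ i)"
      by (rule sum.mono_neutral_left) (auto simp: parity_coeff_def)
    finally show ?thesis .
  qed
  then show ?thesis
    using assms by (simp add: type_A_def type_B_def) (simp add: parity_coeff_def)
qed

text \<open>
  The bound \<open>n \<le> k\<close> matters: for \<open>n > k\<close> truncated subtraction leaves one term in the sum
  defining \<^const>\<open>beta_B\<close>, whereas the sum defining \<^const>\<open>beta_A\<close> is empty.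
\<close>

lemma beta_A_parity_coeff:
  assumes "n \<le> k"
  shows "beta_A k (parity_coeff a) p n = beta_B k a p n"
proof
  fix x
  have "beta_B k a p n x = (\<Sum>j | n \<le> j \<and> j \<le> k \<and> even (j - n). parity_coeff a j n * p j x)"
    unfolding beta_B_def using assms
    by (intro sum.reindex_bij_witness[of _ "\<lambda>j. (j - n) div 2" "\<lambda>i. 2 * i + n"])
      (auto simp: parity_coeff_def)
  also have "\<dots> = (\<Sum>j=n..k. parity_coeff a j n * p j x)"
    by (rule sum.mono_neutral_left) (auto simp: parity_coeff_def)
  finally show "beta_A k (parity_coeff a) p n x = beta_B k a p n x"
    by (simp add: beta_A_def)
qed

section \<open>The representation theorem\<close>

theorem theorem3:
  fixes I :: "real set" and w :: "real \<Rightarrow> real" and V :: "(real \<Rightarrow> real) set"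
    and k :: nat and a :: "nat \<Rightarrow> nat \<Rightarrow> real" and p :: "nat \<Rightarrow> real \<Rightarrow> real"
  assumes "weighted_function_space I w V"
    and "poly_space I k \<subseteq> V"
  shows "(type_A I w V k a p \<longrightarrow>
            (\<forall>f\<in>V. orth_projector I w V (poly_space I k) f
               = (\<Sum>i=0..k. fscale (wip I w f (beta_A k a p i)) (monomial_on I i)))) \<and>
         (type_B I w V k a p \<longrightarrow>
            (\<forall>f\<in>V. orth_projector I w V (poly_space I k) f
               = (\<Sum>i=0..k. fscale (wip I w f (beta_B k a p i)) (monomial_on I i))))"
proof (intro conjI impI ballI)
  interpret weighted_function_space I w V by fact
  fix f assume f: "f \<in> V"
  show "orth_projector I w V (poly_space I k) f
      = (\<Sum>i=0..k. fscale (wip I w f (beta_A k a p i)) (monomial_on I i))"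
    if "type_A I w V k a p"
    using that f by (rule orth_projector_type_A)
  show "orth_projector I w V (poly_space I k) f
      = (\<Sum>i=0..k. fscale (wip I w f (beta_B k a p i)) (monomial_on I i))"
    if "type_B I w V k a p"
    using orth_projector_type_A[OF type_A_parity_coeff[OF that] f]
    by (simp add: beta_A_parity_coeff)
qed

end
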